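(* Let $G$ be a countable discrete amenable group, $(V,\|\cdot\|)$ a complete semi-normed (real) vector space, and $\pi: G \to \mathrm{Isom}(V)$ a uniformly bounded representation. If a set map $\varphi \in \mathcal{M}$ is asymptotically additive, then there exists an additive set map $\psi \in \mathcal{M}_\oplus$ such that $$\lim_{F \to G}\left\|\frac{\varphi(F)}{|F|} -\frac{\psi(F)}{|F|}\right\| = 0.$$
   Context: $\mathcal{F}(G)$ is the set of non-empty finite subsets of $G$. For $K\in\mathcal{F}(G)$ and $\delta>0$, a set $F\in\mathcal{F}(G)$ is $(K,\delta)$-invariant if $|KF\,\Delta\, F|\le \delta|F|$; $G$ is amenable if a $(K,\delta)$-invariant set exists for every $(K,\delta)\in\mathcal{F}(G)\times\mathbb{R}_{>0}$. For $\rho:\mathcal{F}(G)\to\mathbb{R}$ and $L\in\mathbb{R}$, $\lim_{F\to G}\rho(F)=L$ means: for every $\epsilon>0$ there is $(K,\delta)\in\mathcal{F}(G)\times\mathbb{R}_{>0}$ such that $|\rho(F)-L|<\epsilon$ for every $(K,\delta)$-invariant $F$. Also $\limsup_{F\to G}\rho(F):=\inf_{(K,\delta)}\sup\{\rho(F): F \text{ is } (K,\delta)\text{-invariant}\}$. $V$ is complete: every $\|\cdot\|$-Cauchy sequence has a $\|\cdot\|$-limit in $V$. $\mathrm{Isom}(V)$ denotes the group of bounded invertible linear operators on $V$ (not necessarily isometries); a representation is a group homomorphism $\pi:G\to\mathrm{Isom}(V)$; it is uniformly bounded if $C_\pi:=\sup_{g\in G}\|\pi(g)\|_{\mathrm{op}}<\infty$.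 A set map is a function $\varphi:\mathcal{F}(G)\to V$. It is $G$-equivariant if $\pi(g)\varphi(F)=\varphi(Fg^{-1})$ for all $g\in G$, $F\in\mathcal{F}(G)$, and bounded if $\sup_{F\in\mathcal{F}(G)}\|\varphi(F)/|F|\|<\infty$. $\mathcal{M}$ is the space of bounded and $G$-equivariant set maps. $\varphi\in\mathcal{M}$ is additive if $\varphi(E\sqcup F)=\varphi(E)+\varphi(F)$ for all disjoint $E,F\in\mathcal{F}(G)$; $\mathcal{M}_\oplus$ is the set of additive maps in $\mathcal{M}$. $\varphi\in\mathcal{M}$ is asymptotically additive if $$\inf_{\psi\in\mathcal{M}_\oplus}\limsup_{F\to G}\left\|\frac{\varphi(F)}{|F|}-\frac{\psi(F)}{|F|}\right\|=0.$$ *)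

theory Defs
  imports "HOL-Analysis.Analysis" "HOL-Algebra.Coset"
begin

section \<open>Amenable groups and limits along invariant sets\<close>

definition fin_subsets :: "('a, 'm) monoid_scheme \<Rightarrow> 'a set set" where
  "fin_subsets G = {F. F \<subseteq> carrier G \<and> finite F \<and> F \<noteq> {}}"

definition invariant_sets :: "('a, 'm) monoid_scheme \<Rightarrow> 'a set \<Rightarrow> real \<Rightarrow> 'a set set" where
  "invariant_sets G K \<delta> =
     {F \<in> fin_subsets G. real (card (sym_diff (K <#>\<^bsub>G\<^esub> F) F)) \<le> \<delta> * real (card F)}"

definition amenable :: "('a, 'm) monoid_scheme \<Rightarrow> bool" where
  "amenable G \<longleftrightarrow> (\<forall>K \<in> fin_subsets G. \<forall>\<delta>>0. invariant_sets G K \<delta> \<noteq> {})"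

definition has_lim :: "('a, 'm) monoid_scheme \<Rightarrow> ('a set \<Rightarrow> real) \<Rightarrow> real \<Rightarrow> bool" where
  "has_lim G \<rho> L \<longleftrightarrow>
     (\<forall>\<epsilon>>0. \<exists>K \<in> fin_subsets G. \<exists>\<delta>>0. \<forall>F \<in> invariant_sets G K \<delta>. \<bar>\<rho> F - L\<bar> < \<epsilon>)"

text \<open>The upper limit is taken in the extended reals, because the suprema need not be finite.\<close>

definition lim_sup :: "('a, 'm) monoid_scheme \<Rightarrow> ('a set \<Rightarrow> real) \<Rightarrow> ereal" where
  "lim_sup G \<rho> =
     (INF (K, \<delta>) \<in> fin_subsets G \<times> {0<..}. SUP F \<in> invariant_sets G K \<delta>. ereal (\<rho> F))"

section \<open>Semi-normed spaces and uniformly bounded representations\<close>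

definition seminorm :: "('v::real_vector \<Rightarrow> real) \<Rightarrow> bool" where
  "seminorm p \<longleftrightarrow> (\<forall>x. 0 \<le> p x) \<and> (\<forall>x y. p (x + y) \<le> p x + p y) \<and> (\<forall>c x. p (c *\<^sub>R x) = \<bar>c\<bar> * p x)"

definition seminorm_complete :: "('v::real_vector \<Rightarrow> real) \<Rightarrow> bool" where
  "seminorm_complete p \<longleftrightarrow>
     (\<forall>X :: nat \<Rightarrow> 'v. (\<forall>\<epsilon>>0. \<exists>N. \<forall>m\<ge>N. \<forall>n\<ge>N. p (X m - X n) < \<epsilon>)
        \<longrightarrow> (\<exists>l. (\<lambda>n. p (X n - l)) \<longlonglongrightarrow> 0))"

definition bounded_op :: "('v::real_vector \<Rightarrow> real) \<Rightarrow> ('v \<Rightarrow> 'v) \<Rightarrow> bool" where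
  "bounded_op p T \<longleftrightarrow> linear T \<and> (\<exists>C. \<forall>v. p (T v) \<le> C * p v)"

definition op_norm :: "('v::real_vector \<Rightarrow> real) \<Rightarrow> ('v \<Rightarrow> 'v) \<Rightarrow> real" where
  "op_norm p T = (SUP v \<in> {v. p v \<le> 1}. p (T v))"

text \<open>Invertibility is meant in the algebra of bounded operators: the inverse is bounded as well.\<close>

definition Isom :: "('v::real_vector \<Rightarrow> real) \<Rightarrow> ('v \<Rightarrow> 'v) monoid" where
  "Isom p =
     \<lparr>carrier = {T. bounded_op p T \<and> bij T \<and> bounded_op p (inv_into UNIV T)}, mult = (\<circ>), one = id\<rparr>"

lemma bounded_op_comp:
  assumes "seminorm p" "bounded_op p S" "bounded_op p T"
  shows "bounded_op p (S \<circ> T)"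
proof -
  obtain C where C: "\<And>v. p (S v) \<le> C * p v"
    using assms(2) unfolding bounded_op_def by blast
  obtain D where D: "\<And>v. p (T v) \<le> D * p v"
    using assms(3) unfolding bounded_op_def by blast
  have nn: "0 \<le> p v" for v
    using assms(1) unfolding seminorm_def by blast
  have "p (S (T v)) \<le> (\<bar>C\<bar> * D) * p v" for v
  proof -
    have "p (S (T v)) \<le> \<bar>C\<bar> * p (T v)"
      using C[of "T v"] mult_right_mono[OF abs_ge_self[of C] nn[of "T v"]] by linarith
    also have "\<dots> \<le> \<bar>C\<bar> * (D * p v)"
      by (rule mult_left_mono[OF D]) simp
    finally show ?thesis by (simp add: mult.assoc)
  qed
  moreover have "linear (S \<circ> T)"
    using assms(2,3) by (simp add: bounded_op_def linear_compose)
  ultimately show ?thesis unfolding bounded_op_def comp_def by blast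
qed

lemma group_Isom:
  assumes "seminorm p"
  shows "group (Isom p)"
proof (rule groupI)
  fix S T assume "S \<in> carrier (Isom p)" "T \<in> carrier (Isom p)"
  then show "S \<otimes>\<^bsub>Isom p\<^esub> T \<in> carrier (Isom p)"
    by (auto simp: Isom_def bij_comp o_inv_distrib intro!: bounded_op_comp[OF assms])
next
  have "bounded_op p id"
    unfolding bounded_op_def by (auto intro!: exI[of _ 1] linear_id)
  then show "\<one>\<^bsub>Isom p\<^esub> \<in> carrier (Isom p)"
    by (simp add: Isom_def)
next
  fix T assume T: "T \<in> carrier (Isom p)"
  then have "inv_into UNIV T \<in> carrier (Isom p)" "inv_into UNIV T \<otimes>\<^bsub>Isom p\<^esub> T = \<one>\<^bsub>Isom p\<^esub>"
    by (auto simp: Isom_def bij_imp_bij_inv inv_inv_eq bij_is_inj)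
  then show "\<exists>S\<in>carrier (Isom p). S \<otimes>\<^bsub>Isom p\<^esub> T = \<one>\<^bsub>Isom p\<^esub>" by blast
qed (auto simp: Isom_def comp_assoc)

definition uniformly_bounded ::
    "('a, 'm) monoid_scheme \<Rightarrow> ('v::real_vector \<Rightarrow> real) \<Rightarrow> ('a \<Rightarrow> 'v \<Rightarrow> 'v) \<Rightarrow> bool" where
  "uniformly_bounded G p \<pi> \<longleftrightarrow> bdd_above ((\<lambda>g. op_norm p (\<pi> g)) ` carrier G)"

section \<open>Set maps\<close>

text \<open>
  A set map is represented by a total function on \<open>'a set\<close>; only its values on
  \<open>fin_subsets G\<close> are relevant.
\<close>

definition equivariant ::
    "('a, 'm) monoid_scheme \<Rightarrow> ('a \<Rightarrow> 'v \<Rightarrow> 'v) \<Rightarrow> ('a set \<Rightarrow> 'v) \<Rightarrow> bool" where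
  "equivariant G \<pi> \<phi> \<longleftrightarrow>
     (\<forall>g \<in> carrier G. \<forall>F \<in> fin_subsets G. \<pi> g (\<phi> F) = \<phi> (F #>\<^bsub>G\<^esub> inv\<^bsub>G\<^esub> g))"

definition mean_value :: "('a set \<Rightarrow> 'v::real_vector) \<Rightarrow> 'a set \<Rightarrow> 'v" where
  "mean_value \<phi> F = \<phi> F /\<^sub>R real (card F)"

definition bounded_set_map ::
    "('a, 'm) monoid_scheme \<Rightarrow> ('v::real_vector \<Rightarrow> real) \<Rightarrow> ('a set \<Rightarrow> 'v) \<Rightarrow> bool" where
  "bounded_set_map G p \<phi> \<longleftrightarrow> bdd_above ((\<lambda>F. p (mean_value \<phi> F)) ` fin_subsets G)"

definition set_maps ::
    "('a, 'm) monoid_scheme \<Rightarrow> ('v::real_vector \<Rightarrow> real) \<Rightarrow> ('a \<Rightarrow> 'v \<Rightarrow> 'v) \<Rightarrow> ('a set \<Rightarrow> 'v) set" where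
  "set_maps G p \<pi> = {\<phi>. bounded_set_map G p \<phi> \<and> equivariant G \<pi> \<phi>}"

definition additive_set_maps ::
    "('a, 'm) monoid_scheme \<Rightarrow> ('v::real_vector \<Rightarrow> real) \<Rightarrow> ('a \<Rightarrow> 'v \<Rightarrow> 'v) \<Rightarrow> ('a set \<Rightarrow> 'v) set" where
  "additive_set_maps G p \<pi> =
     {\<phi> \<in> set_maps G p \<pi>.
        \<forall>E \<in> fin_subsets G. \<forall>F \<in> fin_subsets G. E \<inter> F = {} \<longrightarrow> \<phi> (E \<union> F) = \<phi> E + \<phi> F}"

definition asymptotically_additive ::
    "('a, 'm) monoid_scheme \<Rightarrow> ('v::real_vector \<Rightarrow> real) \<Rightarrow> ('a \<Rightarrow> 'v \<Rightarrow> 'v) \<Rightarrow> ('a set \<Rightarrow> 'v) \<Rightarrow> bool" where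
  "asymptotically_additive G p \<pi> \<phi> \<longleftrightarrow>
     \<phi> \<in> set_maps G p \<pi> \<and>
     (INF \<psi> \<in> additive_set_maps G p \<pi>. lim_sup G (\<lambda>F. p (mean_value \<phi> F - mean_value \<psi> F))) = 0"

end

theory Submission
  imports Defs
begin

text \<open>
  An additive equivariant set map is determined by its value \<open>v\<close> at \<open>{\<one>}\<close>: it is
  \<open>F \<mapsto> \<Sum>f\<in>F. \<pi> (inv f) v\<close>, the \<^emph>\<open>orbit sum\<close> of \<open>v\<close>. Asymptotic additivity thus provides
  vectors \<open>v\<^sub>n\<close> whose orbit averages approximate \<open>\<phi>\<close> up to \<open>2\<^sup>-\<^sup>n\<close> on sufficiently invariant
  sets. The sequence \<open>v\<^sub>n\<close> itself need not be Cauchy; only the orbit averages of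
  \<open>v\<^sub>n\<^sub>+\<^sub>1 - v\<^sub>n\<close> are eventually small.

  The remedy is to change the \<open>v\<^sub>n\<close> by \<^emph>\<open>negligible\<close> vectors, those whose orbit averages tend to
  zero. By uniform boundedness, translating a sufficiently invariant set hardly affects an
  orbit average, so \<open>v - \<pi> (inv f) v\<close> is negligible, and therefore so is the difference between
  \<open>v\<close> and any orbit average of \<open>v\<close> (\<open>negligible_minus_average\<close>). A vector with eventually small
  orbit averages is consequently small up to a negligible vector, namely one of these averages
  (\<open>small_representative\<close>); amenability supplies the set over which to average.

  Replacing each increment \<open>v\<^sub>n\<^sub>+\<^sub>1 - v\<^sub>n\<close> by a small representative turns \<open>v\<^sub>n\<close> into a Cauchy
  sequence \<open>u\<^sub>n\<close> with \<open>v\<^sub>n - u\<^sub>n\<close> negligible. The orbit sum of a limit of \<open>u\<^sub>n\<close> is the desired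
  additive map, because orbit averaging is Lipschitz uniformly in the set.
\<close>

section \<open>The filter of increasingly invariant sets\<close>

definition invariance_filter :: "('a, 'm) monoid_scheme \<Rightarrow> 'a set filter" where
  "invariance_filter G =
     (INF (K, \<delta>) \<in> fin_subsets G \<times> {0<..}. principal (invariant_sets G K \<delta>))"

text \<open>
  The invariance condition is not monotone in \<open>K\<close> on the nose, since the part of \<open>F\<close> that \<open>KF\<close>
  misses may grow when \<open>K\<close> shrinks. Left translation preserves cardinality, however, so \<open>KF\<close> has
  at least as many elements as \<open>F\<close>, and the missed part is no larger than the excess \<open>KF - F\<close>,
  which is monotone. This costs the factor two.
\<close>

lemma (in group) invariant_sets_shrink:
  assumes K: "K \<subseteq> K'" "K \<in> fin_subsets G" "K' \<in> fin_subsets G" and F: "F \<in> invariant_sets G K' \<delta>"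
  shows "F \<in> invariant_sets G K (2 * \<delta>)"
proof -
  have Ff: "F \<subseteq> carrier G" "finite F" "F \<noteq> {}"
    and inv: "real (card (sym_diff (K' <#> F) F)) \<le> \<delta> * real (card F)"
    using F by (auto simp: invariant_sets_def fin_subsets_def)
  have fin: "finite (K <#> F)" "finite (K' <#> F)"
    using K Ff by (auto simp: set_mult_def fin_subsets_def)
  obtain k where k: "k \<in> K" "k \<in> carrier G"
    using K(2) by (auto simp: fin_subsets_def)
  have "card F = card ((\<lambda>x. k \<otimes> x) ` F)"
    using k Ff by (intro card_image[symmetric] inj_onI) (auto simp: subset_iff)
  also have "\<dots> \<le> card (K <#> F)"
    using k fin by (intro card_mono) (auto simp: set_mult_def)
  finally have "card (F - (K <#> F)) \<le> card ((K <#> F) - F)"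
    using card_Diff_subset_Int[of F "K <#> F"] card_Diff_subset_Int[of "K <#> F" F] fin Ff
    by (simp add: Int_commute)
  moreover have "card ((K <#> F) - F) \<le> card (sym_diff (K' <#> F) F)"
    using K fin Ff by (intro card_mono) (auto simp: set_mult_def)
  moreover have "card (sym_diff (K <#> F) F) = card ((K <#> F) - F) + card (F - (K <#> F))"
    using fin Ff by (intro card_Un_disjoint) auto
  ultimately have "real (card (sym_diff (K <#> F) F)) \<le> 2 * \<delta> * real (card F)"
    using inv by linarith
  then show ?thesis
    using Ff by (simp add: invariant_sets_def fin_subsets_def)
qed

lemma invariant_sets_mono:
  assumes "\<delta> \<le> \<delta>'"
  shows "invariant_sets G K \<delta> \<subseteq> invariant_sets G K \<delta>'"
proof
  fix F assume F: "F \<in> invariant_sets G K \<delta>"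
  have "\<delta> * real (card F) \<le> \<delta>' * real (card F)"
    using assms by (simp add: mult_right_mono)
  then show "F \<in> invariant_sets G K \<delta>'"
    using F by (auto simp: invariant_sets_def)
qed

lemma (in group) eventually_invariance_filter:
  "eventually P (invariance_filter G) \<longleftrightarrow>
     (\<exists>K \<in> fin_subsets G. \<exists>\<delta>>0. \<forall>F \<in> invariant_sets G K \<delta>. P F)"
proof -
  let ?B = "fin_subsets G \<times> {0<..} :: ('a set \<times> real) set"
  let ?F = "\<lambda>(K, \<delta>). principal (invariant_sets G K \<delta>)"
  have "({\<one>}, 1) \<in> ?B"
    by (simp add: fin_subsets_def)
  then have ne: "?B \<noteq> {}"
    by blast
  have dir: "\<exists>x\<in>?B. ?F x \<le> inf (?F a) (?F b)" if ab: "a \<in> ?B" "b \<in> ?B" for a b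
  proof -
    obtain K \<delta> L \<eta> where a: "a = (K, \<delta>)" and b: "b = (L, \<eta>)"
      by (cases a, cases b) blast
    define d where "d = min \<delta> \<eta> / 2"
    have KL: "K \<in> fin_subsets G" "L \<in> fin_subsets G" "K \<union> L \<in> fin_subsets G"
      using ab a b by (auto simp: fin_subsets_def)
    have d: "0 < d" "2 * d \<le> \<delta>" "2 * d \<le> \<eta>"
      using ab a b by (auto simp: d_def)
    have "invariant_sets G (K \<union> L) d \<subseteq> invariant_sets G K \<delta> \<inter> invariant_sets G L \<eta>"
      using invariant_sets_shrink[of K "K \<union> L" _ d] invariant_sets_shrink[of L "K \<union> L" _ d] KL
        invariant_sets_mono[OF d(2), of G K] invariant_sets_mono[OF d(3), of G L]
      by blast
    then show ?thesis
      using KL d a b by (intro bexI[of _ "(K \<union> L, d)"]) auto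
  qed
  show ?thesis
    unfolding invariance_filter_def
    by (subst eventually_INF_base[where F = ?F and B = ?B, OF ne dir]) (auto simp: eventually_principal)
qed

lemma (in group) has_lim_iff_tendsto:
  "has_lim G \<rho> L \<longleftrightarrow> (\<rho> \<longlongrightarrow> L) (invariance_filter G)"
  unfolding has_lim_def tendsto_iff eventually_invariance_filter dist_real_def ..

lemma (in group) eventually_fin_subsets: "eventually (\<lambda>F. F \<in> fin_subsets G) (invariance_filter G)"
  unfolding eventually_invariance_filter
  by (intro bexI[of _ "{\<one>}"] exI[of _ 1]) (auto simp: invariant_sets_def fin_subsets_def)

lemma (in group) invariance_filter_neq_bot:
  assumes "amenable G"
  shows "invariance_filter G \<noteq> bot"
  using assms unfolding trivial_limit_def eventually_invariance_filter amenable_def by blast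

lemma (in group) eventually_less_of_lim_sup:
  assumes "lim_sup G \<rho> < ereal e"
  shows "eventually (\<lambda>F. \<rho> F < e) (invariance_filter G)"
proof -
  obtain K \<delta> where "K \<in> fin_subsets G" "0 < \<delta>" "(SUP F \<in> invariant_sets G K \<delta>. ereal (\<rho> F)) < ereal e"
    using assms unfolding lim_sup_def INF_less_iff by auto
  moreover from this(3) have "\<rho> F < e" if "F \<in> invariant_sets G K \<delta>" for F
    using SUP_lessD[OF _ that] by (metis less_ereal.simps(1))
  ultimately show ?thesis
    unfolding eventually_invariance_filter by blast
qed

section \<open>Orbit sums and additive set maps\<close>

lemma seminorm_sum_le:
  assumes "seminorm p"
  shows "p (sum f A) \<le> (\<Sum>x\<in>A. p (f x))"
proof (induction A rule: infinite_finite_induct)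
  case (insert x A)
  have "p (f x + sum f A) \<le> p (f x) + p (sum f A)"
    using assms by (simp add: seminorm_def)
  then show ?case
    using insert by simp
next
  case (infinite A)
  have "p (0 *\<^sub>R 0) = \<bar>0\<bar> * p 0"
    using assms by (metis seminorm_def)
  then show ?case
    using infinite by simp
next
  case empty
  have "p (0 *\<^sub>R 0) = \<bar>0\<bar> * p 0"
    using assms by (metis seminorm_def)
  then show ?case
    by simp
qed

locale uniformly_bounded_representation = group G for G (structure) +
  fixes p :: "'v::real_vector \<Rightarrow> real" and \<pi> :: "'a \<Rightarrow> 'v \<Rightarrow> 'v"
  assumes seminorm: "seminorm p"
    and rep: "\<pi> \<in> hom G (Isom p)"
    and unif_bdd: "uniformly_bounded G p \<pi>"
begin

lemma p_nonneg [simp]: "0 \<le> p x"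
  and p_triangle: "p (x + y) \<le> p x + p y"
  and p_scaleR: "p (c *\<^sub>R x) = \<bar>c\<bar> * p x"
  using seminorm by (auto simp: seminorm_def)

lemma p_zero [simp]: "p 0 = 0"
  using p_scaleR[of 0 0] by simp

lemma p_minus_commute: "p (x - y) = p (y - x)"
  using p_scaleR[of "-1" "x - y"] by simp

lemma p_triangle_diff: "p (x - z) \<le> p (x - y) + p (y - z)"
  using p_triangle[of "x - y" "y - z"] by simp

lemma rep_bounded: "g \<in> carrier G \<Longrightarrow> bounded_op p (\<pi> g)"
  using rep by (auto simp: hom_def Isom_def)

lemma rep_linear: "g \<in> carrier G \<Longrightarrow> linear (\<pi> g)"
  using rep_bounded by (auto simp: bounded_op_def)

lemma rep_mult: "g \<in> carrier G \<Longrightarrow> h \<in> carrier G \<Longrightarrow> \<pi> (g \<otimes> h) v = \<pi> g (\<pi> h v)"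
  using rep by (auto simp: hom_def Isom_def)

lemma rep_one: "\<pi> \<one> v = v"
proof -
  interpret h: group_hom G "Isom p" \<pi>
    by (intro group_hom.intro group_hom_axioms.intro is_group group_Isom[OF seminorm] rep)
  show ?thesis
    using h.hom_one by (simp add: Isom_def)
qed

text \<open>
  The supremum in the operator norm only controls vectors in the unit ball. Rescaling covers the
  vectors of positive seminorm, and vectors of seminorm zero are mapped to such vectors by
  boundedness of each single operator.
\<close>

lemma rep_uniform_bound:
  "\<exists>C\<ge>0. \<forall>g\<in>carrier G. \<forall>v. p (\<pi> g v) \<le> C * p v"
proof -
  obtain C where C: "op_norm p (\<pi> g) \<le> C" if "g \<in> carrier G" for g
    using unif_bdd by (auto simp: uniformly_bounded_def bdd_above_def)
  have "p (\<pi> g v) \<le> \<bar>C\<bar> * p v" if g: "g \<in> carrier G" for g v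
  proof -
    obtain D where D: "p (\<pi> g w) \<le> D * p w" for w
      using rep_bounded[OF g] by (auto simp: bounded_op_def)
    have "p (\<pi> g w) \<le> \<bar>D\<bar>" if "p w \<le> 1" for w
    proof -
      have "D * p w \<le> \<bar>D\<bar> * 1"
        using that by (intro mult_mono) auto
      with D[of w] show ?thesis by simp
    qed
    then have "bdd_above ((\<lambda>w. p (\<pi> g w)) ` {w. p w \<le> 1})"
      by (auto simp: bdd_above_def)
    then have unit: "p (\<pi> g w) \<le> \<bar>C\<bar>" if "p w \<le> 1" for w
      using cSUP_upper[of w "{w. p w \<le> 1}" "\<lambda>w. p (\<pi> g w)"] that C[OF g]
      by (simp add: op_norm_def)
    show ?thesis
    proof (cases "p v = 0")
      case True
      then show ?thesis using D[of v] by simp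
    next
      case False
      then have pos: "0 < p v"
        using p_nonneg[of v] by linarith
      have "p (\<pi> g (v /\<^sub>R p v)) \<le> \<bar>C\<bar>"
        using pos by (intro unit) (simp add: p_scaleR)
      then have "p (\<pi> g v) / p v \<le> \<bar>C\<bar>"
        using pos by (simp add: linear_scale[OF rep_linear[OF g]] p_scaleR divide_inverse mult.commute)
      then show ?thesis
        using pos by (simp add: divide_le_eq)
    qed
  qed
  then show ?thesis
    by (intro exI[of _ "\<bar>C\<bar>"]) simp
qed

definition orbit_sum :: "'v \<Rightarrow> 'a set \<Rightarrow> 'v" where
  "orbit_sum v F = (\<Sum>f\<in>F. \<pi> (inv f) v)"

abbreviation orbit_average :: "'v \<Rightarrow> 'a set \<Rightarrow> 'v" where
  "orbit_average v \<equiv> mean_value (orbit_sum v)"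

lemma linear_orbit_average:
  assumes "F \<subseteq> carrier G"
  shows "linear (\<lambda>v. orbit_average v F)"
proof -
  have "linear (\<lambda>v. orbit_sum v F)"
    unfolding orbit_sum_def using assms by (intro linear_compose_sum ballI rep_linear) auto
  then show ?thesis
    unfolding mean_value_def by (rule linear_compose_scale_right)
qed

lemma orbit_average_bound:
  "\<exists>C\<ge>0. \<forall>F\<in>fin_subsets G. \<forall>v. p (orbit_average v F) \<le> C * p v"
proof -
  obtain C where C: "0 \<le> C" "\<And>g v. g \<in> carrier G \<Longrightarrow> p (\<pi> g v) \<le> C * p v"
    using rep_uniform_bound by blast
  have "p (orbit_average v F) \<le> C * p v" if F: "F \<in> fin_subsets G" for F v
  proof -
    have pos: "0 < card F"
      using F by (auto simp: fin_subsets_def card_gt_0_iff)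
    have "p (orbit_sum v F) \<le> (\<Sum>f\<in>F. p (\<pi> (inv f) v))"
      unfolding orbit_sum_def by (rule seminorm_sum_le[OF seminorm])
    also have "\<dots> \<le> (\<Sum>f\<in>F. C * p v)"
      using F by (intro sum_mono C) (auto simp: fin_subsets_def)
    finally show ?thesis
      using pos by (simp add: mean_value_def p_scaleR field_simps)
  qed
  with C(1) show ?thesis
    by blast
qed

lemma equivariant_orbit_sum: "equivariant G \<pi> (orbit_sum v)"
  unfolding equivariant_def
proof (intro ballI)
  fix g F assume g: "g \<in> carrier G" and F: "F \<in> fin_subsets G"
  then have sub: "F \<subseteq> carrier G"
    by (simp add: fin_subsets_def)
  have inj: "inj_on (\<lambda>f. f \<otimes> inv g) F"
    using g sub by (intro inj_onI) (auto simp: subset_iff)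
  have "\<pi> g (orbit_sum v F) = (\<Sum>f\<in>F. \<pi> g (\<pi> (inv f) v))"
    unfolding orbit_sum_def by (rule linear_sum[OF rep_linear[OF g]])
  also have "\<dots> = (\<Sum>f\<in>F. \<pi> (inv (f \<otimes> inv g)) v)"
    using g sub by (intro sum.cong) (auto simp: rep_mult[symmetric] inv_mult_group)
  also have "\<dots> = orbit_sum v ((\<lambda>f. f \<otimes> inv g) ` F)"
    by (simp add: orbit_sum_def sum.reindex[OF inj])
  also have "(\<lambda>f. f \<otimes> inv g) ` F = F #> inv g"
    by (auto simp: r_coset_def)
  finally show "\<pi> g (orbit_sum v F) = orbit_sum v (F #> inv g)" .
qed

lemma orbit_sum_in_additive_set_maps: "orbit_sum v \<in> additive_set_maps G p \<pi>"
proof -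
  obtain C where "\<And>F v. F \<in> fin_subsets G \<Longrightarrow> p (orbit_average v F) \<le> C * p v"
    using orbit_average_bound by blast
  then have "bounded_set_map G p (orbit_sum v)"
    unfolding bounded_set_map_def by (rule bdd_aboveI2)
  moreover have "orbit_sum v (E \<union> F) = orbit_sum v E + orbit_sum v F"
    if "E \<in> fin_subsets G" "F \<in> fin_subsets G" "E \<inter> F = {}" for E F
    using that by (simp add: orbit_sum_def fin_subsets_def sum.union_disjoint)
  ultimately show ?thesis
    using equivariant_orbit_sum unfolding additive_set_maps_def set_maps_def by blast
qed

lemma additive_set_map_eq_orbit_sum:
  assumes \<psi>: "\<psi> \<in> additive_set_maps G p \<pi>" and F: "F \<in> fin_subsets G"
  shows "\<psi> F = orbit_sum (\<psi> {\<one>}) F"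
proof -
  have single: "\<psi> {f} = \<pi> (inv f) (\<psi> {\<one>})" if "f \<in> carrier G" for f
  proof -
    have "\<pi> (inv f) (\<psi> {\<one>}) = \<psi> ({\<one>} #> inv (inv f))"
      using \<psi> that by (simp add: additive_set_maps_def set_maps_def equivariant_def fin_subsets_def)
    also have "{\<one>} #> inv (inv f) = {f}"
      using that by (simp add: r_coset_def)
    finally show ?thesis by simp
  qed
  have "finite F" "F \<noteq> {}" "F \<subseteq> carrier G"
    using F by (auto simp: fin_subsets_def)
  then show ?thesis
  proof (induction F rule: finite_ne_induct)
    case (singleton x)
    then show ?case by (simp add: single[of x] orbit_sum_def)
  next
    case (insert x F)
    have "{x} \<in> fin_subsets G" "F \<in> fin_subsets G" "{x} \<inter> F = {}"
      using insert by (auto simp: fin_subsets_def)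
    then have "\<psi> ({x} \<union> F) = \<psi> {x} + \<psi> F"
      using \<psi> unfolding additive_set_maps_def by blast
    then show ?case
      using insert by (simp add: single[of x] orbit_sum_def)
  qed
qed

section \<open>Negligible vectors\<close>

definition negligible_vector :: "'v \<Rightarrow> bool" where
  "negligible_vector v \<longleftrightarrow> ((\<lambda>F. p (orbit_average v F)) \<longlongrightarrow> 0) (invariance_filter G)"

lemma negligible_vector_zero: "negligible_vector 0"
proof -
  have "eventually (\<lambda>F. p (orbit_average 0 F) = 0) (invariance_filter G)"
    using eventually_fin_subsets
    by eventually_elim (simp add: fin_subsets_def linear_0[OF linear_orbit_average])
  then show ?thesis
    unfolding negligible_vector_def by (rule tendsto_eventually)
qed

lemma negligible_vector_add:
  assumes "negligible_vector v" "negligible_vector w"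
  shows "negligible_vector (v + w)"
  unfolding negligible_vector_def
proof (rule tendsto_sandwich[of "\<lambda>_. 0"])
  show "((\<lambda>F. p (orbit_average v F) + p (orbit_average w F)) \<longlongrightarrow> 0) (invariance_filter G)"
    using tendsto_add[OF assms[unfolded negligible_vector_def]] by simp
  show "eventually (\<lambda>F. p (orbit_average (v + w) F) \<le> p (orbit_average v F) + p (orbit_average w F))
          (invariance_filter G)"
    using eventually_fin_subsets
    by eventually_elim (simp add: fin_subsets_def linear_add[OF linear_orbit_average] p_triangle)
qed auto

lemma negligible_vector_scaleR:
  assumes "negligible_vector v"
  shows "negligible_vector (c *\<^sub>R v)"
  unfolding negligible_vector_def
proof (rule tendsto_cong[THEN iffD1])
  show "((\<lambda>F. \<bar>c\<bar> * p (orbit_average v F)) \<longlongrightarrow> 0) (invariance_filter G)"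
    using tendsto_mult_right_zero[OF assms[unfolded negligible_vector_def]] .
  show "eventually (\<lambda>F. \<bar>c\<bar> * p (orbit_average v F) = p (orbit_average (c *\<^sub>R v) F))
          (invariance_filter G)"
    using eventually_fin_subsets
    by eventually_elim (simp add: fin_subsets_def linear_scale[OF linear_orbit_average] p_scaleR)
qed

lemma negligible_vector_sum:
  assumes "\<And>i. i \<in> I \<Longrightarrow> negligible_vector (v i)"
  shows "negligible_vector (sum v I)"
  using assms
  by (induction I rule: infinite_finite_induct) (auto intro: negligible_vector_zero negligible_vector_add)

text \<open>
  The orbit sum of \<open>\<pi> (inv f) v\<close> over \<open>F\<close> is the orbit sum of \<open>v\<close> over the translate \<open>fF\<close>, so the
  two orbit sums differ only on the symmetric difference of \<open>fF\<close> and \<open>F\<close>.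
\<close>

lemma negligible_minus_translate:
  assumes f: "f \<in> carrier G"
  shows "negligible_vector (v - \<pi> (inv f) v)"
proof -
  obtain C where C: "0 \<le> C" "\<And>g v. g \<in> carrier G \<Longrightarrow> p (\<pi> g v) \<le> C * p v"
    using rep_uniform_bound by blast
  have bound: "p (orbit_average (v - \<pi> (inv f) v) F) \<le> \<delta> * (C * p v)"
    if F: "F \<in> invariant_sets G {f} \<delta>" for F \<delta>
  proof -
    define fF where "fF = {f} <#> F"
    have Ff: "F \<subseteq> carrier G" "finite F" "F \<noteq> {}"
      and inv: "real (card (sym_diff fF F)) \<le> \<delta> * real (card F)"
      using F by (auto simp: invariant_sets_def fin_subsets_def fF_def)
    have img: "fF = (\<lambda>g. f \<otimes> g) ` F"
      by (auto simp: set_mult_def fF_def)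
    have fin: "finite fF" "fF \<subseteq> carrier G"
      using Ff f by (auto simp: img)
    have inj: "inj_on (\<lambda>g. f \<otimes> g) F"
      using f Ff by (intro inj_onI) (auto simp: subset_iff)
    let ?x = "\<lambda>g. \<pi> (inv g) v"
    have "orbit_sum (\<pi> (inv f) v) F = (\<Sum>g\<in>F. ?x (f \<otimes> g))"
      unfolding orbit_sum_def using f Ff
      by (intro sum.cong) (auto simp: rep_mult[symmetric] inv_mult_group)
    also have "\<dots> = sum ?x fF"
      by (simp add: img sum.reindex[OF inj])
    finally have tr: "orbit_sum (\<pi> (inv f) v) F = sum ?x fF" .
    have "orbit_sum (v - \<pi> (inv f) v) F = (\<Sum>g\<in>F. ?x g - \<pi> (inv g) (\<pi> (inv f) v))"
      unfolding orbit_sum_def using Ff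
      by (intro sum.cong) (auto intro!: linear_diff rep_linear)
    also have "\<dots> = sum ?x F - sum ?x fF"
      using tr by (simp add: sum_subtractf orbit_sum_def)
    also have "\<dots> = sum ?x (F - fF) - sum ?x (fF - F)"
      using sum.Int_Diff[OF Ff(2), of ?x fF] sum.Int_Diff[OF fin(1), of ?x F]
      by (simp add: Int_commute)
    finally have "p (orbit_sum (v - \<pi> (inv f) v) F) \<le> p (sum ?x (F - fF)) + p (sum ?x (fF - F))"
      using p_triangle_diff[of "sum ?x (F - fF)" "sum ?x (fF - F)" 0]
        p_minus_commute[of 0 "sum ?x (fF - F)"] by simp
    also have "\<dots> \<le> (\<Sum>g\<in>F - fF. p (?x g)) + (\<Sum>g\<in>fF - F. p (?x g))"
      by (intro add_mono seminorm_sum_le seminorm)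
    also have "\<dots> = (\<Sum>g\<in>sym_diff fF F. p (?x g))"
      using Ff fin by (subst sum.union_disjoint) auto
    also have "\<dots> \<le> (\<Sum>g\<in>sym_diff fF F. C * p v)"
      using Ff fin by (intro sum_mono C) auto
    also have "\<dots> = real (card (sym_diff fF F)) * (C * p v)"
      by simp
    also have "\<dots> \<le> \<delta> * real (card F) * (C * p v)"
      using C by (intro mult_right_mono inv) simp
    finally show ?thesis
      using Ff by (simp add: mean_value_def p_scaleR field_simps card_gt_0_iff)
  qed
  show ?thesis
    unfolding negligible_vector_def has_lim_iff_tendsto[symmetric] has_lim_def
  proof (intro allI impI)
    fix e :: real assume e: "0 < e"
    have pos: "0 < C * p v + 1"
      using C(1) by (simp add: add_nonneg_pos)
    \<comment> \<open>The summand 1 only guards against a vanishing bound \<open>C * p v\<close>.\<close>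
    define \<delta> where "\<delta> = e / (C * p v + 1)"
    have \<delta>: "0 < \<delta>" "\<delta> * (C * p v) < e"
      using e pos by (simp_all add: \<delta>_def field_simps)
    have "\<bar>p (orbit_average (v - \<pi> (inv f) v) F) - 0\<bar> < e" if "F \<in> invariant_sets G {f} \<delta>" for F
      using bound[OF that] \<delta> by simp
    then show "\<exists>K\<in>fin_subsets G. \<exists>\<delta>>0. \<forall>F\<in>invariant_sets G K \<delta>.
        \<bar>p (orbit_average (v - \<pi> (inv f) v) F) - 0\<bar> < e"
      using f \<delta>(1) by (intro bexI[of _ "{f}"] exI[of _ \<delta>]) (auto simp: fin_subsets_def)
  qed
qed

lemma negligible_minus_average:
  assumes "F \<in> fin_subsets G"
  shows "negligible_vector (v - orbit_average v F)"
proof -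
  have F: "F \<subseteq> carrier G" "finite F" "F \<noteq> {}"
    using assms by (auto simp: fin_subsets_def)
  have "(\<Sum>f\<in>F. v - \<pi> (inv f) v) = real (card F) *\<^sub>R v - orbit_sum v F"
    by (simp add: sum_subtractf orbit_sum_def sum_constant_scaleR)
  then have "v - orbit_average v F = inverse (real (card F)) *\<^sub>R (\<Sum>f\<in>F. v - \<pi> (inv f) v)"
    using F by (simp add: mean_value_def scaleR_diff_right)
  then show ?thesis
    using F by (auto intro!: negligible_vector_scaleR negligible_vector_sum negligible_minus_translate)
qed

text \<open>
  In other words, the seminorm \<open>limsup p (orbit_average v F)\<close> is at least the quotient seminorm of
  \<open>p\<close> modulo negligible vectors. This is what lets completeness of \<open>p\<close> be used for it.
\<close>

lemma small_representative:
  assumes "amenable G"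
    and "eventually (\<lambda>F. p (orbit_average v F) < e) (invariance_filter G)"
  obtains w where "p w < e" "negligible_vector (v - w)"
proof -
  have "eventually (\<lambda>F. F \<in> fin_subsets G \<and> p (orbit_average v F) < e) (invariance_filter G)"
    using eventually_fin_subsets assms(2) by (rule eventually_conj)
  then obtain F where "F \<in> fin_subsets G" "p (orbit_average v F) < e"
    using eventually_happens'[OF invariance_filter_neq_bot[OF assms(1)]] by blast
  then show thesis
    using that negligible_minus_average by blast
qed

section \<open>Limits of approximating additive maps\<close>

lemma seminorm_complete_geometric:
  assumes complete: "seminorm_complete p" and step: "\<And>n. p (u (Suc n) - u n) \<le> B * (1/2)^n"
  obtains l where "(\<lambda>n. p (u n - l)) \<longlonglongrightarrow> 0"
proof -
  have "0 \<le> B"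
    using order_trans[OF p_nonneg step[of 0]] by simp
  have tail: "p (u (n + k) - u n) \<le> 2 * B * (1/2)^n - 2 * B * (1/2)^(n + k)" for n k
  proof (induction k)
    case (Suc k)
    have "p (u (n + Suc k) - u n) \<le> p (u (Suc (n + k)) - u (n + k)) + p (u (n + k) - u n)"
      using p_triangle_diff[of "u (n + Suc k)" "u n" "u (n + k)"] by simp
    also have "\<dots> \<le> B * (1/2)^(n + k) + (2 * B * (1/2)^n - 2 * B * (1/2)^(n + k))"
      by (intro add_mono step Suc.IH)
    finally show ?case by simp
  qed simp
  have tail': "p (u m - u n) \<le> 2 * B * (1/2)^n" if "n \<le> m" for m n
  proof -
    have "0 \<le> 2 * B * (1/2)^m"
      using \<open>0 \<le> B\<close> by simp
    then show ?thesis
      using tail[of n "m - n"] that by simp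
  qed
  have "\<exists>N. \<forall>m\<ge>N. \<forall>n\<ge>N. p (u m - u n) < e" if "0 < e" for e
  proof -
    have "(\<lambda>n. 4 * B * (1/2::real)^n) \<longlonglongrightarrow> 0"
      by (intro tendsto_mult_right_zero LIMSEQ_realpow_zero) auto
    then have "eventually (\<lambda>n. 4 * B * (1/2::real)^n < e) sequentially"
      using that by (rule order_tendstoD(2))
    then obtain N where N: "4 * B * (1/2::real)^N < e"
      by (auto simp: eventually_sequentially)
    have "p (u m - u n) < e" if "m \<ge> N" "n \<ge> N" for m n
      using p_triangle_diff[of "u m" "u n" "u N"] tail'[OF that(1)] tail'[OF that(2)] N
        p_minus_commute[of "u N" "u n"] by linarith
    then show ?thesis by blast
  qed
  with complete that show thesis
    unfolding seminorm_complete_def by blast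
qed

lemma asymptotically_additive_approximation:
  assumes "asymptotically_additive G p \<pi> \<phi>" "0 < e"
  shows "\<exists>v. eventually (\<lambda>F. p (mean_value \<phi> F - orbit_average v F) < e) (invariance_filter G)"
proof -
  have "(INF \<psi> \<in> additive_set_maps G p \<pi>. lim_sup G (\<lambda>F. p (mean_value \<phi> F - mean_value \<psi> F)))
          < ereal e"
    using assms by (simp add: asymptotically_additive_def)
  then obtain \<psi> where \<psi>: "\<psi> \<in> additive_set_maps G p \<pi>"
    and "lim_sup G (\<lambda>F. p (mean_value \<phi> F - mean_value \<psi> F)) < ereal e"
    by (auto simp: INF_less_iff)
  then have "eventually (\<lambda>F. p (mean_value \<phi> F - mean_value \<psi> F) < e) (invariance_filter G)"
    by (intro eventually_less_of_lim_sup)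
  then have "eventually (\<lambda>F. p (mean_value \<phi> F - orbit_average (\<psi> {\<one>}) F) < e) (invariance_filter G)"
    using eventually_fin_subsets
    by eventually_elim (simp add: mean_value_def additive_set_map_eq_orbit_sum[OF \<psi>])
  then show ?thesis ..
qed

text \<open>
  Orbit averaging is uniformly Lipschitz and insensitive to negligible corrections, so a vector
  that is a limit of the \<open>v n\<close> up to such corrections inherits their approximation of \<open>\<phi>\<close>.
\<close>

lemma tendsto_orbit_average_of_limit:
  assumes approx: "\<And>n. eventually (\<lambda>F. p (mean_value \<phi> F - orbit_average (v n) F) < e n)
      (invariance_filter G)"
    and e: "e \<longlonglongrightarrow> 0"
    and negl: "\<And>n. negligible_vector (v n - u n)"
    and lim: "(\<lambda>n. p (u n - l)) \<longlonglongrightarrow> 0"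
  shows "((\<lambda>F. p (mean_value \<phi> F - orbit_average l F)) \<longlongrightarrow> 0) (invariance_filter G)"
proof (rule order_tendstoI)
  fix r :: real assume "0 < r"
  obtain C where C: "\<And>F v. F \<in> fin_subsets G \<Longrightarrow> p (orbit_average v F) \<le> C * p v"
    using orbit_average_bound by blast
  have "(\<lambda>n. e n + C * p (u n - l)) \<longlonglongrightarrow> 0 + C * 0"
    by (intro tendsto_intros e lim)
  then have "eventually (\<lambda>n. e n + C * p (u n - l) < r / 2) sequentially"
    using \<open>0 < r\<close> by (intro order_tendstoD(2)) auto
  then obtain n where n: "e n + C * p (u n - l) < r / 2"
    by (auto simp: eventually_sequentially)
  have "eventually (\<lambda>F. p (orbit_average (v n - u n) F) < r / 2) (invariance_filter G)"
    using negl[of n] \<open>0 < r\<close> unfolding negligible_vector_def by (intro order_tendstoD(2)) auto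
  then show "eventually (\<lambda>F. p (mean_value \<phi> F - orbit_average l F) < r) (invariance_filter G)"
    using approx[of n] eventually_fin_subsets
  proof eventually_elim
    case (elim F)
    have diff: "orbit_average (x - y) F = orbit_average x F - orbit_average y F" for x y
      using elim(3) by (simp add: fin_subsets_def linear_diff[OF linear_orbit_average])
    show ?case
      using p_triangle_diff[of "mean_value \<phi> F" "orbit_average l F" "orbit_average (v n) F"]
        p_triangle_diff[of "orbit_average (v n) F" "orbit_average l F" "orbit_average (u n) F"]
        elim(1,2) C[OF elim(3), of "u n - l"] n
      unfolding diff by linarith
  qed
next
  fix r :: real assume "r < 0"
  then show "eventually (\<lambda>F. r < p (mean_value \<phi> F - orbit_average l F)) (invariance_filter G)"
    by (intro always_eventually allI) (rule less_le_trans[OF _ p_nonneg])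
qed

lemma additive_limit_of_asymptotically_additive:
  assumes amen: "amenable G" and complete: "seminorm_complete p"
    and asym: "asymptotically_additive G p \<pi> \<phi>"
  shows "\<exists>l. ((\<lambda>F. p (mean_value \<phi> F - orbit_average l F)) \<longlongrightarrow> 0) (invariance_filter G)"
proof -
  let ?approx = "\<lambda>n v. eventually (\<lambda>F. p (mean_value \<phi> F - orbit_average v F) < (1/2)^n)
    (invariance_filter G)"
  have "\<forall>n. \<exists>v. ?approx n v"
    by (intro allI asymptotically_additive_approximation[OF asym]) simp
  then obtain v where v: "?approx n (v n)" for n
    by metis
  have "\<exists>w. p w < 2 * (1/2)^n \<and> negligible_vector (v (Suc n) - v n - w)" for n
  proof -
    have "eventually (\<lambda>F. p (orbit_average (v (Suc n) - v n) F) < 2 * (1/2)^n) (invariance_filter G)"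
      using v[of n] v[of "Suc n"] eventually_fin_subsets
    proof eventually_elim
      case (elim F)
      have diff: "orbit_average (v (Suc n) - v n) F = orbit_average (v (Suc n)) F - orbit_average (v n) F"
        using elim(3) by (simp add: fin_subsets_def linear_diff[OF linear_orbit_average])
      have "(1/2::real)^Suc n \<le> (1/2)^n"
        by simp
      then show ?case
        using p_triangle_diff[of "orbit_average (v (Suc n)) F" "orbit_average (v n) F" "mean_value \<phi> F"]
          p_minus_commute[of "orbit_average (v (Suc n)) F" "mean_value \<phi> F"] elim(1,2)
        unfolding diff by linarith
    qed
    then show ?thesis
      using small_representative[OF amen] by metis
  qed
  then obtain w where w: "p (w n) < 2 * (1/2)^n" "negligible_vector (v (Suc n) - v n - w n)" for n
    by metis
  define u where "u n = v 0 + (\<Sum>k<n. w k)" for n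
  have "p (u (Suc n) - u n) \<le> 2 * (1/2)^n" for n
    using w(1)[of n] by (simp add: u_def)
  then obtain l where l: "(\<lambda>n. p (u n - l)) \<longlonglongrightarrow> 0"
    using seminorm_complete_geometric[OF complete] by blast
  have negl: "negligible_vector (v n - u n)" for n
  proof (induction n)
    case 0
    then show ?case by (simp add: u_def negligible_vector_zero)
  next
    case (Suc n)
    have "v (Suc n) - u (Suc n) = (v n - u n) + (v (Suc n) - v n - w n)"
      by (simp add: u_def)
    then show ?case
      using negligible_vector_add[OF Suc.IH w(2)] by (simp only:)
  qed
  have "(\<lambda>n. (1/2::real)^n) \<longlonglongrightarrow> 0"
    by (intro LIMSEQ_realpow_zero) auto
  then show ?thesis
    using tendsto_orbit_average_of_limit[OF v _ negl l] by blast
qed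

end

theorem theorem1:
  fixes G :: "('a, 'm) monoid_scheme"
    and p :: "'v::real_vector \<Rightarrow> real"
    and \<pi> :: "'a \<Rightarrow> 'v \<Rightarrow> 'v"
    and \<phi> :: "'a set \<Rightarrow> 'v"
  assumes "group G" and "countable (carrier G)" and "amenable G"
    and "seminorm p" and "seminorm_complete p"
    and "\<pi> \<in> hom G (Isom p)" and "uniformly_bounded G p \<pi>"
    and "\<phi> \<in> set_maps G p \<pi>" and "asymptotically_additive G p \<pi> \<phi>"
  shows "\<exists>\<psi> \<in> additive_set_maps G p \<pi>.
           has_lim G (\<lambda>F. p (mean_value \<phi> F - mean_value \<psi> F)) 0"
proof -
  interpret uniformly_bounded_representation G p \<pi>
    using assms
    by (intro uniformly_bounded_representation.intro uniformly_bounded_representation_axioms.intro)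
  obtain l where "((\<lambda>F. p (mean_value \<phi> F - orbit_average l F)) \<longlongrightarrow> 0) (invariance_filter G)"
    using additive_limit_of_asymptotically_additive assms by blast
  then show ?thesis
    unfolding has_lim_iff_tendsto using orbit_sum_in_additive_set_maps by blast
qed

end
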